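(* Let $\{Z_n\}_{n\ge 0}$ be a branching process in an i.i.d. random environment, with $X=\ln m_0$, $\mu=\mathbb{E}X$, $\sigma^2=\mathbb{E}(X-\mu)^2$ as in the context, such that almost surely every individual has at least one child and $0<\sigma^2<\infty$. Assume that for some $\alpha\in(0,1)$, $$\mathbb{E}\big[(X-\mu)^2\exp\{((X-\mu)^+)^\alpha\}\big]<\infty,$$ where $a^+=\max(a,0)$. Put $$u=\frac{1}{\sigma^2}\,\mathbb{E}\big[(X-\mu)^2\exp\{((X-\mu)^+)^\alpha\}\big].$$ Then for all integers $n_0\ge 0$, $n\ge 1$ and all real $x>0$, $$\mathbb{P}\left(\frac{\ln\frac{Z_{n_0+n}}{Z_{n_0}}-n\mu}{\sigma\sqrt n}\ge x\right)\le 3\exp\left\{-\frac{x^2}{8\left(u+(\sigma\sqrt n)^{-\alpha}x^{2-\alpha}\right)}\right\}.$$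
   Context: Branching process in a random environment: $\xi=(\xi_0,\xi_1,\dots)$ is a sequence of i.i.d. random variables (the environment). Each value of $\xi_n$ determines a probability distribution $p(\xi_n)=\{p_n(i): i\in\mathbb{N}\}$ on $\mathbb{N}=\{0,1,2,\dots\}$ (the offspring law at generation $n$). The process is defined by $Z_0=1$ and $Z_{n+1}=\sum_{i=1}^{Z_n}N_{n,i}$ for $n\ge 0$, where, conditionally on $\xi$, the variables $\{N_{n,i}: n\ge0,i\ge1\}$ are independent and, for each $n$, the $N_{n,i}$ $(i\ge1)$ have common law $p(\xi_n)$. $\mathbb{P}$ is the total (annealed) law, i.e. $\mathbb{P}(dx,d\xi)=\mathbb{P}_\xi(dx)\tau(d\xi)$ with $\mathbb{P}_\xi$ the conditional law given $\xi$ and $\tau$ the law of $\xi$; $\mathbb{E}$ is the corresponding expectation. Put $m_n=\sum_{i\ge0} i\,p_n(i)$ (conditional mean offspring number at generation $n$ given $\xi$), $X=\ln m_0$, $\mu=\mathbb{E}X$, $\sigma^2=\mathbb{E}(X-\mu)^2$, $\sigma>0$. Standing assumption: $p_0(0)=0$ almost surely (the probability of having no children is zero) and $0<\sigma^2<\infty$; hence $Z_n\ge1$ a.s. for all $n$. *)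

theory Defs
  imports "HOL-Probability.Probability"
begin

definition quenched_law :: "('e \<Rightarrow> nat pmf) \<Rightarrow> (nat \<Rightarrow> 'e) \<Rightarrow> (nat \<times> nat \<Rightarrow> nat) measure" where
  "quenched_law p e = PiM (UNIV \<times> {1..}) (\<lambda>(n, i). measure_pmf (p (e n)))"

primrec generation_size :: "(nat \<Rightarrow> nat \<Rightarrow> 'a \<Rightarrow> nat) \<Rightarrow> nat \<Rightarrow> 'a \<Rightarrow> nat" where
  "generation_size N 0 \<omega> = 1"
| "generation_size N (Suc n) \<omega> = (\<Sum>i = 1..generation_size N n \<omega>. N n i \<omega>)"

text \<open>
  If the series diverges (infinite mean) the value below is a junk value, so finiteness
  of the mean has to be assumed where this is used.
\<close>

definition offspring_mean :: "('e \<Rightarrow> nat pmf) \<Rightarrow> 'e \<Rightarrow> real" where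
  "offspring_mean p e = (\<Sum>i. real i * pmf (p e) i)"

text \<open>
  The environment takes values in an arbitrary measurable space \<open>E\<close>. The assumption
  \<open>annealed\<close> says that \<open>quenched_law p \<xi>\<close> is the conditional law of the offspring
  variables \<open>N n i\<close> (\<open>i \<ge> 1\<close>) given \<open>\<xi>\<close>, i.e. that the joint law of \<open>\<xi>\<close> and \<open>N\<close> is
  \<open>P\<^sub>\<xi>(dx) \<tau>(d\<xi>)\<close>, written out on measurable rectangles.
\<close>

locale branching_process_random_env = prob_space M for M :: "'a measure" +
  fixes E :: "'e measure"
    and p :: "'e \<Rightarrow> nat pmf"
    and \<xi> :: "nat \<Rightarrow> 'a \<Rightarrow> 'e"
    and N :: "nat \<Rightarrow> nat \<Rightarrow> 'a \<Rightarrow> nat"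
  assumes offspring_law_measurable: "\<And>i. (\<lambda>e. pmf (p e) i) \<in> borel_measurable E"
    and env_indep: "indep_vars (\<lambda>_. E) \<xi> UNIV"
    and env_ident: "\<And>n. distr M E (\<xi> n) = distr M E (\<xi> 0)"
    and offspring_measurable: "\<And>n i. i \<ge> 1 \<Longrightarrow> N n i \<in> measurable M (count_space UNIV)"
    and annealed:
      "\<And>A B. A \<in> sets (PiM UNIV (\<lambda>_. E)) \<Longrightarrow>
        B \<in> sets (PiM (UNIV \<times> {1..}) (\<lambda>_. count_space UNIV)) \<Longrightarrow>
        emeasure M {\<omega> \<in> space M. (\<lambda>n. \<xi> n \<omega>) \<in> A \<and> (\<lambda>(n, i)\<in>UNIV \<times> {1..}. N n i \<omega>) \<in> B} =
        (\<integral>\<^sup>+ e. emeasure (quenched_law p e) B * indicator A e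
          \<partial>distr M (PiM UNIV (\<lambda>_. E)) (\<lambda>\<omega> n. \<xi> n \<omega>))"

end

theory Submission
  imports Defs
begin

text \<open>
  Write \<open>s = \<sigma> \<surd>n\<close> and \<open>y = x s / 2\<close>. The logarithm of \<open>Z (n0 + n) / Z n0\<close> is the sum of the
  \<open>n\<close> variables \<open>ln m\<^sub>k\<close> and of the logarithm of the normalized ratio
  \<open>W = (Z (n0 + n) / Z n0) / \<Prod> m\<^sub>k\<close>, so one of the two exceeds its share \<open>y\<close> of the deviation \<open>2 y\<close>.

  Given the environment \<open>W\<close> has mean at most 1, so Markov bounds \<open>P(ln W \<ge> y)\<close> by \<open>exp (- y)\<close>. This is
  below the claimed exponential if \<open>2 y \<ge> 1\<close>, and otherwise the claimed bound exceeds 1.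

  The centred sum is treated by truncation at \<open>y\<close>. With \<open>B = n \<sigma>\<^sup>2 u\<close> the parameter
  \<open>l = y / (B + y powr (2 - \<alpha>))\<close> is at most \<open>y powr (\<alpha> - 1)\<close>, so \<open>l v \<le> v powr \<alpha>\<close> for \<open>0 < v \<le> y\<close>
  and \<open>B\<close> controls the truncated moment generating function at \<open>l\<close>. The probability that some
  summand exceeds \<open>y\<close> is at most \<open>B / y\<^sup>2 * exp (- (y powr \<alpha>))\<close>, and if \<open>y\<^sup>2 < B\<close> the bound is trivial.
\<close>

section \<open>Exponential inequalities and a tail bound for independent sums\<close>

lemma exp_le_quadratic:
  fixes z :: real
  shows "exp z \<le> 1 + z + z\<^sup>2 / 2 * exp (max z 0)"
proof (cases "z \<ge> 0")
  case True
  obtain t where t: "\<bar>t\<bar> \<le> \<bar>z\<bar>" "exp z = (\<Sum>m<2. z ^ m / fact m) + exp t / fact 2 * z ^ 2"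
    using Maclaurin_exp_le by blast
  from t(2) have eq: "exp z = 1 + z + z\<^sup>2 / 2 * exp t"
    by (simp add: numeral_2_eq_2)
  have "exp t \<le> exp (max z 0)"
    using t(1) True by auto
  then have "z\<^sup>2 / 2 * exp t \<le> z\<^sup>2 / 2 * exp (max z 0)"
    by (intro mult_left_mono) auto
  with eq show ?thesis by linarith
next
  case False
  \<comment> \<open>For negative \<open>z\<close> the factor \<open>exp (max z 0)\<close> is 1 and
    the quadratic Taylor polynomial already dominates: the difference is nondecreasing, because its
    derivative \<open>exp t - 1 - t\<close> is never negative, and it vanishes at 0.\<close>
  have "exp z - 1 - z - z\<^sup>2 / 2 \<le> exp 0 - 1 - 0 - 0\<^sup>2 / (2::real)"
  proof (rule DERIV_nonneg_imp_nondecreasing[of z 0 "\<lambda>z. exp z - 1 - z - z\<^sup>2 / 2"])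
    show "z \<le> 0" using False by simp
    fix t :: real
    have "((\<lambda>z. exp z - 1 - z - z\<^sup>2 / 2) has_real_derivative exp t - 1 - t) (at t)"
      by (auto intro!: derivative_eq_intros)
    moreover have "0 \<le> exp t - 1 - t"
      using exp_ge_add_one_self[of t] by linarith
    ultimately show "\<exists>d. ((\<lambda>z. exp z - 1 - z - z\<^sup>2 / 2) has_real_derivative d) (at t) \<and> 0 \<le> d"
      by blast
  qed
  then show ?thesis using False by simp
qed

text \<open>Since \<open>\<alpha> < 1\<close>, the function \<open>v powr (\<alpha> - 1)\<close>
  decreases, so the bound on \<open>l\<close> at the truncation level \<open>y\<close> passes to
  every \<open>0 < w \<le> y\<close> and gives \<open>l * w \<le> w powr \<alpha>\<close>. The
  exponential weight on the right thus no longer involves \<open>l\<close>.\<close>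

lemma exp_mult_le_truncated:
  fixes w l y \<alpha> :: real
  assumes "w \<le> y" "0 \<le> l" "l \<le> y powr (\<alpha> - 1)" "0 < y" "\<alpha> < 1"
  shows "exp (l * w) \<le> 1 + l * w + l\<^sup>2 / 2 * (w\<^sup>2 * exp (max w 0 powr \<alpha>))"
proof -
  have "l * max w 0 \<le> max w 0 powr \<alpha>"
  proof (cases "w > 0")
    case True
    have "l * w \<le> y powr (\<alpha> - 1) * w"
      using True assms by (intro mult_right_mono) auto
    also have "\<dots> \<le> w powr (\<alpha> - 1) * w"
      using True assms by (intro mult_right_mono powr_mono2') auto
    also have "\<dots> = w powr \<alpha>"
      using True by (simp add: powr_diff)
    finally show ?thesis using True by simp
  qed simp
  moreover have "max (l * w) 0 = l * max w 0"
    using assms(2) by (auto simp: max_def mult_nonneg_nonneg mult_le_0_iff zero_le_mult_iff)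
  ultimately have "exp (max (l * w) 0) \<le> exp (max w 0 powr \<alpha>)"
    by simp
  then have "(l * w)\<^sup>2 / 2 * exp (max (l * w) 0) \<le> (l * w)\<^sup>2 / 2 * exp (max w 0 powr \<alpha>)"
    by (intro mult_left_mono) auto
  with exp_le_quadratic[of "l * w"] show ?thesis
    by (simp add: power_mult_distrib mult_ac)
qed

lemma (in prob_space) indep_vars_expectation_prod_le:
  fixes U :: "'i \<Rightarrow> 'a \<Rightarrow> real"
  assumes "finite I" "indep_vars (\<lambda>_. borel) U I"
    and "\<And>i. i \<in> I \<Longrightarrow> integrable M (U i)" "\<And>i \<omega>. i \<in> I \<Longrightarrow> 0 \<le> U i \<omega>"
    and "\<And>i. i \<in> I \<Longrightarrow> expectation (U i) \<le> exp (b i)"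
  shows "expectation (\<lambda>\<omega>. \<Prod>i\<in>I. U i \<omega>) \<le> exp (\<Sum>i\<in>I. b i)"
proof -
  have "expectation (\<lambda>\<omega>. \<Prod>i\<in>I. U i \<omega>) = (\<Prod>i\<in>I. expectation (U i))"
    using assms by (intro indep_vars_lebesgue_integral)
  also have "\<dots> \<le> (\<Prod>i\<in>I. exp (b i))"
    using assms by (intro prod_mono) (auto intro!: Bochner_Integration.integral_nonneg)
  finally show ?thesis
    using assms(1) by (simp add: exp_sum)
qed

text \<open>Two events cover the deviation, whence the factor 2: some summand exceeds
  \<open>y\<close> (union bound and Markov for \<open>Q\<close>), or the truncated exponentials have
  a large product (Chernoff bound). Each has at most the stated exponential as its probability,
  unless the whole bound is trivial.\<close>

lemma (in prob_space) indep_sum_subexponential_tail: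
  fixes Y :: "'i \<Rightarrow> 'a \<Rightarrow> real" and \<alpha> y :: real
  defines "Q \<equiv> \<lambda>i \<omega>. (Y i \<omega>)\<^sup>2 * exp (max (Y i \<omega>) 0 powr \<alpha>)"
  assumes fin: "finite I" and ind: "indep_vars (\<lambda>_. borel) Y I"
    and int: "\<And>i. i \<in> I \<Longrightarrow> integrable M (Y i)"
    and mean: "\<And>i. i \<in> I \<Longrightarrow> expectation (Y i) \<le> 0"
    and intQ: "\<And>i. i \<in> I \<Longrightarrow> integrable M (Q i)"
    and \<alpha>: "0 < \<alpha>" "\<alpha> < 1" and y: "0 < y"
    and B: "B = (\<Sum>i\<in>I. expectation (Q i))"
  shows "prob {\<omega> \<in> space M. y \<le> (\<Sum>i\<in>I. Y i \<omega>)}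
    \<le> 2 * exp (- (y\<^sup>2 / (2 * (B + y powr (2 - \<alpha>)))))"
proof -
  have Y[measurable]: "Y i \<in> borel_measurable M" if "i \<in> I" for i
    using int[OF that] by simp
  have Q0: "0 \<le> Q i \<omega>" for i \<omega>
    by (simp add: Q_def)
  have EQ0: "0 \<le> expectation (Q i)" for i
    by (intro Bochner_Integration.integral_nonneg Q0)
  have B0: "0 \<le> B"
    unfolding B by (intro sum_nonneg EQ0)
  define D where "D = B + y powr (2 - \<alpha>)"
  have D: "0 < D" "B \<le> D" "y powr (2 - \<alpha>) \<le> D"
    using B0 y by (auto simp: D_def add_nonneg_pos)
  \<comment> \<open>This \<open>l\<close> minimizes \<open>l\<^sup>2 / 2 * D - l * y\<close>, with
    minimum \<open>- (y\<^sup>2 / (2 * D))\<close>. Enlarging \<open>B\<close> to \<open>D\<close>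
    by \<open>y powr (2 - \<alpha>)\<close> keeps \<open>l\<close> below
    \<open>y powr (\<alpha> - 1)\<close>, as the truncated inequality demands.\<close>
  define l where "l = y / D"
  have l0: "0 < l"
    using y D by (simp add: l_def)
  have ypow: "y powr (\<alpha> - 1) * y powr (2 - \<alpha>) = y" "y powr \<alpha> * y powr (2 - \<alpha>) = y\<^sup>2"
    using y by (simp_all flip: powr_add)
  have "y \<le> y powr (\<alpha> - 1) * D"
    using mult_left_mono[OF D(3), of "y powr (\<alpha> - 1)"] ypow(1) by simp
  then have ly: "l \<le> y powr (\<alpha> - 1)"
    using D by (simp add: l_def field_simps)
  \<comment> \<open>This prepares the large-summand event: its factor
    \<open>exp (- (y powr \<alpha>))\<close> will be at most the target exponential.\<close>
  have "y\<^sup>2 \<le> y powr \<alpha> * D"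
    using mult_left_mono[OF D(3), of "y powr \<alpha>"] ypow(2) by simp
  moreover have "0 \<le> y powr \<alpha> * D"
    using D by simp
  ultimately have "y\<^sup>2 \<le> y powr \<alpha> * (2 * D)"
    by linarith
  then have eD: "y\<^sup>2 / (2 * D) \<le> y powr \<alpha>"
    using D by (simp add: pos_divide_le_eq)
  show ?thesis
  proof (cases "y\<^sup>2 < B")
    case True
    \<comment> \<open>As \<open>B \<le> D\<close>, the exponent is at most 1/2, and
      \<open>2 * exp (- 1/2)\<close> is at least 1.\<close>
    then have "y\<^sup>2 / (2 * D) \<le> 1 / 2"
      using D by (simp add: field_simps)
    then have "1 / 2 \<le> exp (- (y\<^sup>2 / (2 * D)))"
      using exp_ge_add_one_self[of "- (y\<^sup>2 / (2 * D))"] by linarith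
    then show ?thesis
      using prob_le_1[of "{\<omega> \<in> space M. y \<le> (\<Sum>i\<in>I. Y i \<omega>)}"] unfolding D_def by linarith
  next
    case False
    \<comment> \<open>The value 0 above the level makes \<open>U i\<close> bounded, hence integrable
      although \<open>exp (l * Y i)\<close> need not be. The quadratic bound survives there, since
      its right side is nonnegative when \<open>Y i \<omega> > y > 0\<close>.\<close>
    define U where "U i \<omega> = (if Y i \<omega> \<le> y then exp (l * Y i \<omega>) else 0)" for i \<omega>
    have U[measurable]: "U i \<in> borel_measurable M" if "i \<in> I" for i
      using that unfolding U_def by measurable
    have U0: "0 \<le> U i \<omega>" for i \<omega>
      by (simp add: U_def)
    have Ule: "U i \<omega> \<le> 1 + l * Y i \<omega> + l\<^sup>2 / 2 * Q i \<omega>" for i \<omega>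
      using exp_mult_le_truncated[of "Y i \<omega>" y l \<alpha>] l0 ly y \<alpha> Q0[of i \<omega>]
      by (auto simp: U_def Q_def intro!: add_nonneg_nonneg mult_nonneg_nonneg)
    have intU: "integrable M (U i)" if "i \<in> I" for i
    proof (rule integrable_const_bound[where B = "exp (l * y)"])
      show "AE \<omega> in M. norm (U i \<omega>) \<le> exp (l * y)"
        using l0 by (auto simp: U_def)
    qed (use that in simp)
    have EU: "expectation (U i) \<le> exp (l\<^sup>2 / 2 * expectation (Q i))" if "i \<in> I" for i
    proof -
      have "expectation (U i) \<le> expectation (\<lambda>\<omega>. 1 + l * Y i \<omega> + l\<^sup>2 / 2 * Q i \<omega>)"
        using that intU int intQ Ule by (intro integral_mono) auto
      also have "\<dots> = 1 + l * expectation (Y i) + l\<^sup>2 / 2 * expectation (Q i)"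
        using that int intQ by (simp add: prob_space)
      also have "\<dots> \<le> 1 + l\<^sup>2 / 2 * expectation (Q i)"
        using mean[OF that] l0 by (simp add: mult_nonneg_nonpos)
      finally show ?thesis
        using exp_ge_add_one_self[of "l\<^sup>2 / 2 * expectation (Q i)"] by linarith
    qed
    have indU: "indep_vars (\<lambda>_. borel) U I"
      unfolding U_def using indep_vars_compose2[OF ind, of "\<lambda>_ v. if v \<le> y then exp (l * v) else 0" "\<lambda>_. borel"]
      by simp
    have EP: "expectation (\<lambda>\<omega>. \<Prod>i\<in>I. U i \<omega>) \<le> exp (l\<^sup>2 / 2 * B)"
      using indep_vars_expectation_prod_le[OF fin indU intU U0 EU]
      by (simp add: B sum_distrib_left)
    have intP: "integrable M (\<lambda>\<omega>. \<Prod>i\<in>I. U i \<omega>)"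
      using fin indU intU by (intro indep_vars_integrable)
    define G where "G = {\<omega> \<in> space M. exp (l * y) \<le> (\<Prod>i\<in>I. U i \<omega>)}"
    define L where "L i = {\<omega> \<in> space M. y < Y i \<omega>}" for i
    have Gs[measurable]: "G \<in> sets M" unfolding G_def by measurable
    have Ls: "L i \<in> sets M" if "i \<in> I" for i
      unfolding L_def using that by measurable
    have [measurable]: "(\<Union>i\<in>I. L i) \<in> sets M"
      using fin Ls by (intro sets.finite_UN) auto
    have "prob G \<le> expectation (\<lambda>\<omega>. \<Prod>i\<in>I. U i \<omega>) / exp (l * y)"
      unfolding G_def by (rule integral_Markov_inequality_measure[OF intP, of "{}"])
        (auto intro!: prod_nonneg U0)
    also have "\<dots> \<le> exp (l\<^sup>2 / 2 * B) / exp (l * y)"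
      by (intro divide_right_mono EP) simp
    also have "\<dots> = exp (l\<^sup>2 / 2 * B - l * y)"
      by (simp add: exp_diff)
    also have "\<dots> \<le> exp (l\<^sup>2 / 2 * D - l * y)"
      using D by (simp add: mult_left_mono)
    also have "l\<^sup>2 / 2 * D - l * y = - (y\<^sup>2 / (2 * D))"
      using D by (simp add: l_def field_simps power2_eq_square)
    finally have PG: "prob G \<le> exp (- (y\<^sup>2 / (2 * D)))" .
    have PL: "prob (L i) \<le> expectation (Q i) / (y\<^sup>2 * exp (y powr \<alpha>))" if "i \<in> I" for i
    proof -
      have "L i \<subseteq> {\<omega> \<in> space M. y\<^sup>2 * exp (y powr \<alpha>) \<le> Q i \<omega>}"
        using y \<alpha> by (auto simp: L_def Q_def intro!: mult_mono power_mono powr_mono2)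
      moreover have "{\<omega> \<in> space M. y\<^sup>2 * exp (y powr \<alpha>) \<le> Q i \<omega>} \<in> sets M"
        using intQ[OF that] by measurable
      ultimately have "prob (L i) \<le> prob {\<omega> \<in> space M. y\<^sup>2 * exp (y powr \<alpha>) \<le> Q i \<omega>}"
        by (intro finite_measure_mono)
      also have "\<dots> \<le> expectation (Q i) / (y\<^sup>2 * exp (y powr \<alpha>))"
        by (rule integral_Markov_inequality_measure[OF intQ[OF that], of "{}"])
          (use y Q0 in auto)
      finally show ?thesis .
    qed
    have "prob (\<Union>i\<in>I. L i) \<le> (\<Sum>i\<in>I. prob (L i))"
      using fin Ls by (intro finite_measure_subadditive_finite) auto
    also have "\<dots> \<le> (\<Sum>i\<in>I. expectation (Q i) / (y\<^sup>2 * exp (y powr \<alpha>)))"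
      by (intro sum_mono PL)
    also have "\<dots> = B / y\<^sup>2 * exp (- (y powr \<alpha>))"
      by (simp add: B exp_minus field_simps flip: sum_divide_distrib)
    \<comment> \<open>In this case \<open>B \<le> y\<^sup>2\<close>, so the polynomial prefactor is
      at most 1.\<close>
    also have "\<dots> \<le> 1 * exp (- (y\<^sup>2 / (2 * D)))"
      using False y eD by (intro mult_mono) (auto simp: field_simps)
    finally have PU: "prob (\<Union>i\<in>I. L i) \<le> exp (- (y\<^sup>2 / (2 * D)))" by simp
    have "{\<omega> \<in> space M. y \<le> (\<Sum>i\<in>I. Y i \<omega>)} \<subseteq> G \<union> (\<Union>i\<in>I. L i)"
    proof
      fix \<omega> assume w: "\<omega> \<in> {\<omega> \<in> space M. y \<le> (\<Sum>i\<in>I. Y i \<omega>)}"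
      show "\<omega> \<in> G \<union> (\<Union>i\<in>I. L i)"
      proof (cases "\<exists>i\<in>I. y < Y i \<omega>")
        case False
        then have "(\<Prod>i\<in>I. U i \<omega>) = (\<Prod>i\<in>I. exp (l * Y i \<omega>))"
          by (intro prod.cong) (auto simp: U_def)
        also have "\<dots> = exp (l * (\<Sum>i\<in>I. Y i \<omega>))"
          using fin by (simp add: exp_sum sum_distrib_left)
        finally show ?thesis
          using w l0 by (auto simp: G_def)
      qed (use w in \<open>auto simp: L_def\<close>)
    qed
    then have "prob {\<omega> \<in> space M. y \<le> (\<Sum>i\<in>I. Y i \<omega>)} \<le> prob (G \<union> (\<Union>i\<in>I. L i))"
      by (intro finite_measure_mono) measurable
    also have "\<dots> \<le> prob G + prob (\<Union>i\<in>I. L i)"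
      by (intro measure_Un_le) measurable
    finally show ?thesis
      using PG PU unfolding D_def by linarith
  qed
qed

section \<open>The quenched law as a probability kernel\<close>

lemma prob_space_quenched_law: "prob_space (quenched_law p e)"
  unfolding quenched_law_def
  by (intro prob_space_PiM) (auto simp: measure_pmf.prob_space_axioms)

lemma sets_quenched_law:
  "sets (quenched_law p e) = sets (PiM (UNIV \<times> {1..}) (\<lambda>_. count_space UNIV))"
  unfolding quenched_law_def by (intro sets_PiM_cong) auto

lemma emeasure_pmf_measurable:
  fixes p :: "'e \<Rightarrow> nat pmf"
  assumes "\<And>i. (\<lambda>e. pmf (p e) i) \<in> borel_measurable E"
  shows "(\<lambda>e. emeasure (measure_pmf (p e)) A) \<in> borel_measurable E"
proof -
  have "emeasure (measure_pmf (p e)) A = (\<Sum>i. ennreal (pmf (p e) i) * indicator A i)" for e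
    by (simp add: nn_integral_measure_pmf nn_integral_count_space_nat
        flip: nn_integral_indicator)
  then show ?thesis
    using assms by simp
qed

text \<open>Measurability in the environment need only be checked on cylinders with finitely many
  constrained coordinates. There the product measure is a finite product of terms that each depend
  on a single \<open>e n\<close>.\<close>

lemma quenched_law_kernel:
  assumes p: "\<And>i. (\<lambda>e. pmf (p e) i) \<in> borel_measurable E"
  shows "quenched_law p \<in> measurable (PiM UNIV (\<lambda>_. E))
    (prob_algebra (PiM (UNIV \<times> {1..}) (\<lambda>_. count_space UNIV)))"
    (is "_ \<in> measurable ?S (prob_algebra ?N)")
proof (rule measurable_prob_algebra_generated[OF sets_PiM Int_stable_prod_algebra prod_algebra_sets_into_space])
  fix e show "prob_space (quenched_law p e)" by (rule prob_space_quenched_law)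
  show "sets (quenched_law p e) = sets ?N" by (rule sets_quenched_law)
next
  fix A assume "A \<in> prod_algebra (UNIV \<times> {1..}) (\<lambda>_::nat \<times> nat. count_space (UNIV::nat set))"
  then obtain J F where A: "A = prod_emb (UNIV \<times> {1..}) (\<lambda>_. count_space UNIV) J (\<Pi>\<^sub>E j\<in>J. F j)"
    and J: "finite J" "J \<subseteq> UNIV \<times> {1..}"
    by (auto elim!: prod_algebraE)
  have "emeasure (quenched_law p e) A = (\<Prod>j\<in>J. emeasure (measure_pmf (p (e (fst j)))) (F j))" for e
  proof -
    \<comment> \<open>\<open>prod_emb\<close> sees only the spaces of the factors, so the counting
      spaces may be exchanged for the offspring laws, which puts \<open>A\<close> in the form whose
      product measure is known.\<close>
    have "A = prod_emb (UNIV \<times> {1..}) (\<lambda>(n, i). measure_pmf (p (e n))) J (\<Pi>\<^sub>E j\<in>J. F j)"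
      unfolding A prod_emb_def by (auto simp: PiE_def Pi_def split: prod.splits)
    then show ?thesis
      unfolding quenched_law_def using J
      by (simp add: emeasure_PiM_emb measure_pmf.prob_space_axioms case_prod_unfold)
  qed
  moreover have "(\<lambda>e. \<Prod>j\<in>J. emeasure (measure_pmf (p (e (fst j)))) (F j)) \<in> borel_measurable ?S"
  proof (intro borel_measurable_prod_ennreal)
    fix j assume "j \<in> J"
    show "(\<lambda>e. emeasure (measure_pmf (p (e (fst j)))) (F j)) \<in> borel_measurable ?S"
      by (rule measurable_compose[OF _ emeasure_pmf_measurable[OF p], of "\<lambda>e. e (fst j)"])
        (rule measurable_component_singleton, simp)
  qed
  ultimately show "(\<lambda>e. emeasure (quenched_law p e) A) \<in> borel_measurable ?S"
    by simp
qed

text \<open>The joint law of the coordinates is the product measure itself, and its factors are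
  their marginals. The criterion for independence by joint laws is applied to nonempty
  \<open>I\<close> only.\<close>

lemma indep_vars_PiM_components:
  assumes "\<And>i. i \<in> I \<Longrightarrow> prob_space (M i)"
  shows "prob_space.indep_vars (PiM I M) M (\<lambda>i \<omega>. \<omega> i) I"
proof (cases "I = {}")
  case True
  interpret prob_space "PiM I M" by (intro prob_space_PiM assms)
  show ?thesis
    unfolding indep_vars_def indep_sets_def by (simp add: True)
next
  case False
  interpret prob_space "PiM I M" by (intro prob_space_PiM assms)
  have "distr (PiM I M) (PiM I M) (\<lambda>x. restrict x I) = distr (PiM I M) (PiM I M) (\<lambda>x. x)"
    by (intro distr_cong) (auto simp: space_PiM)
  also have "\<dots> = PiM I M" by simp
  also have "\<dots> = PiM I (\<lambda>i. distr (PiM I M) (M i) (\<lambda>\<omega>. \<omega> i))"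
    by (intro PiM_cong) (auto simp: distr_PiM_component assms)
  finally show ?thesis
    using False by (subst indep_vars_iff_distr_eq_PiM') auto
qed

section \<open>Mean growth of the generation sizes in a fixed environment\<close>

lemma generation_size_cong:
  assumes "\<And>k i. k < n \<Longrightarrow> 1 \<le> i \<Longrightarrow> N k i \<omega> = N' k i \<omega>'"
  shows "generation_size N n \<omega> = generation_size N' n \<omega>'"
  using assms by (induction n) (auto intro!: sum.cong)

lemma generation_size_measurable:
  assumes "\<And>k i. k < n \<Longrightarrow> 1 \<le> i \<Longrightarrow> N k i \<in> measurable M (count_space UNIV)"
  shows "generation_size N n \<in> measurable M (count_space UNIV)"
  using assms
proof (induction n)
  case 0
  then show ?case by simp
next
  case (Suc n)
  have [measurable]: "generation_size N n \<in> measurable M (count_space UNIV)"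
    using Suc by simp
  have "(\<lambda>\<omega>. \<Sum>i = 1..m. N n i \<omega>) \<in> measurable M (count_space UNIV)" for m
    using Suc.prems by (intro measurable_sum_nat) auto
  \<comment> \<open>The random upper limit takes countably many values, so measurability for each
    fixed limit \<open>m\<close> suffices.\<close>
  then have "(\<lambda>\<omega>. \<Sum>i = 1..generation_size N n \<omega>. N n i \<omega>) \<in> measurable M (count_space UNIV)"
    by (rule measurable_compose_countable[where f = "\<lambda>m \<omega>. \<Sum>i = 1..m. N n i \<omega>"]) simp
  moreover have "generation_size N (Suc n) = (\<lambda>\<omega>. \<Sum>i = 1..generation_size N n \<omega>. N n i \<omega>)"
    by (rule ext) simp
  ultimately show ?case by simp
qed

text \<open>Feeding the coordinates to \<open>generation_size\<close> realizes the process on the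
  canonical sample space of \<open>quenched_law\<close>.\<close>

abbreviation coord :: "nat \<Rightarrow> nat \<Rightarrow> (nat \<times> nat \<Rightarrow> nat) \<Rightarrow> nat" where
  "coord n i x \<equiv> x (n, i)"

lemma coord_measurable:
  assumes "(n, i) \<in> I"
  shows "coord n i \<in> measurable (PiM I (\<lambda>_. count_space UNIV)) (count_space UNIV)"
  using measurable_component_singleton[OF assms] .

text \<open>Given the environment, the size of generation \<open>n\<close> depends on the offspring variables of
  the earlier generations only, and is therefore independent of those of generation \<open>n\<close>.\<close>

lemma nn_integral_generation_ratio_Suc:
  assumes "m \<le> n"
  shows "(\<integral>\<^sup>+x. ennreal (real (generation_size coord (Suc n) x) / real (generation_size coord m x)) \<partial>quenched_law p e)
    = (\<integral>\<^sup>+x. ennreal (real (generation_size coord n x) / real (generation_size coord m x)) \<partial>quenched_law p e)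
      * (\<integral>\<^sup>+j. ennreal (real j) \<partial>measure_pmf (p (e n)))"
proof -
  let ?I = "UNIV \<times> {1..} :: (nat \<times> nat) set"
  let ?M = "\<lambda>(n, i). measure_pmf (p (e n))"
  let ?Q = "quenched_law p e"
  let ?Z = "generation_size coord"
  interpret Q: prob_space ?Q by (rule prob_space_quenched_law)
  have "Q.indep_vars ?M (\<lambda>i \<omega>. \<omega> i) ?I"
    unfolding quenched_law_def
    by (intro indep_vars_PiM_components) (auto simp: measure_pmf.prob_space_axioms)
  then have ind: "Q.indep_vars (\<lambda>_. count_space UNIV) (\<lambda>i \<omega>. \<omega> i) ?I"
    by (rule Q.indep_vars_compose2[where Y = "\<lambda>_ x. x"]) auto
  have Zm[measurable]: "?Z k \<in> measurable ?Q (count_space UNIV)" for k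
    by (subst measurable_cong_sets[OF sets_quenched_law refl], rule generation_size_measurable)
      (auto intro!: coord_measurable)
  have Cm[measurable]: "coord n i \<in> measurable ?Q (count_space UNIV)" if "i \<ge> 1" for i
    by (subst measurable_cong_sets[OF sets_quenched_law refl]) (use that in \<open>auto intro!: coord_measurable\<close>)
  let ?A = "{..<n} \<times> {1..} :: (nat \<times> nat) set"
  \<comment> \<open>The cutoff by \<open>?Z n x\<close> turns a sum of random length into a series
    over all \<open>i\<close>. As \<open>m \<le> n\<close>, the weight \<open>g i\<close> depends on
    the generations before \<open>n\<close> only.\<close>
  define g where "g i x = ennreal (if real i \<le> real (?Z n x) then 1 / real (?Z m x) else 0)" for i x
  have [measurable]: "(\<lambda>x. real (?Z k x)) \<in> borel_measurable ?Q" for k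
    by (rule measurable_compose[OF Zm]) simp
  have gm[measurable]: "g i \<in> borel_measurable ?Q" for i
    unfolding g_def by measurable
  have gA: "g i \<in> borel_measurable (PiM ?A (\<lambda>_. count_space UNIV))" for i
  proof -
    have [measurable]: "(\<lambda>x. real (?Z k x)) \<in> borel_measurable (PiM ?A (\<lambda>_. count_space UNIV))"
      if "k \<le> n" for k
      by (rule measurable_compose[OF generation_size_measurable])
        (use that in \<open>auto intro!: coord_measurable\<close>)
    show ?thesis
      unfolding g_def using assms by measurable
  qed
  have gr: "g i (restrict x ?A) = g i x" for i x
    unfolding g_def using assms
    by (subst (1 2) generation_size_cong[where N' = coord and \<omega>' = x]) auto
  have step: "(\<integral>\<^sup>+x. g i x * ennreal (real (x (n, i))) \<partial>?Q)
      = (\<integral>\<^sup>+x. g i x \<partial>?Q) * (\<integral>\<^sup>+j. ennreal (real j) \<partial>measure_pmf (p (e n)))" if i: "i \<ge> 1" for i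
  proof -
    \<comment> \<open>The index set \<open>?A\<close> of the earlier generations does not contain
      \<open>(n, i)\<close>, so the two restrictions are independent; \<open>g i\<close> factors
      through the first.\<close>
    have "Q.indep_var (PiM ?A (\<lambda>_. count_space UNIV)) (\<lambda>x. restrict x ?A)
        (PiM {(n, i)} (\<lambda>_. count_space UNIV)) (\<lambda>x. restrict x {(n, i)})"
      using Q.indep_var_restrict[OF ind, of ?A "{(n, i)}"] i by auto
    then have "Q.indep_var borel (g i \<circ> (\<lambda>x. restrict x ?A))
        borel ((\<lambda>x. ennreal (real (x (n, i)))) \<circ> (\<lambda>x. restrict x {(n, i)}))"
      by (rule Q.indep_var_compose[OF _ gA]) (intro measurable_compose[OF coord_measurable]; simp)
    then have "Q.indep_var borel (g i) borel (\<lambda>x. ennreal (real (x (n, i))))"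
      by (simp add: comp_def gr del: One_nat_def)
    then have "Q.indep_vars (\<lambda>_. borel) (case_bool (g i) (\<lambda>x. ennreal (real (x (n, i))))) UNIV"
      by (simp add: Q.indep_var_def case_bool_if cong: if_cong)
    from Q.indep_vars_nn_integral[OF _ this]
    have "(\<integral>\<^sup>+x. g i x * ennreal (real (x (n, i))) \<partial>?Q)
        = (\<integral>\<^sup>+x. g i x \<partial>?Q) * (\<integral>\<^sup>+x. ennreal (real (x (n, i))) \<partial>?Q)"
      by (simp add: UNIV_bool mult.commute)
    also have "(\<integral>\<^sup>+x. ennreal (real (x (n, i))) \<partial>?Q)
        = (\<integral>\<^sup>+j. ennreal (real j) \<partial>distr ?Q (measure_pmf (p (e n))) (coord n i))"
      using Cm[OF i] by (subst nn_integral_distr) (auto simp: measurable_def)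
    also have "distr ?Q (measure_pmf (p (e n))) (coord n i) = measure_pmf (p (e n))"
      unfolding quenched_law_def
      using distr_PiM_component[of ?I ?M "(n, i)"] i
      by (auto simp: measure_pmf.prob_space_axioms)
    finally show ?thesis .
  qed
  \<comment> \<open>Individuals are numbered from 1 and series from 0, hence the shift to
    \<open>Suc i\<close>.\<close>
  have "ennreal (real (?Z (Suc n) x) / real (?Z m x)) = (\<Sum>i. g (Suc i) x * ennreal (real (x (n, Suc i))))" for x
  proof -
    have "(\<Sum>i. g (Suc i) x * ennreal (real (x (n, Suc i))))
        = (\<Sum>i<?Z n x. g (Suc i) x * ennreal (real (x (n, Suc i))))"
      by (intro suminf_finite) (auto simp: g_def)
    also have "\<dots> = (\<Sum>i<?Z n x. ennreal (real (x (n, Suc i)) / real (?Z m x)))"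
      by (intro sum.cong) (auto simp: g_def simp flip: ennreal_mult)
    also have "\<dots> = ennreal (\<Sum>i<?Z n x. real (x (n, Suc i)) / real (?Z m x))"
      by (intro sum_ennreal) auto
    also have "(\<Sum>i<?Z n x. real (x (n, Suc i)) / real (?Z m x)) = real (?Z (Suc n) x) / real (?Z m x)"
      by (simp add: sum_divide_distrib sum.shift_bounds_Suc_ivl sum.atLeast1_atMost_eq)
    finally show ?thesis ..
  qed
  then have "(\<integral>\<^sup>+x. ennreal (real (?Z (Suc n) x) / real (?Z m x)) \<partial>?Q)
      = (\<Sum>i. \<integral>\<^sup>+x. g (Suc i) x * ennreal (real (x (n, Suc i))) \<partial>?Q)"
    by (simp add: nn_integral_suminf)
  also have "\<dots> = (\<Sum>i. \<integral>\<^sup>+x. g (Suc i) x \<partial>?Q) * (\<integral>\<^sup>+j. ennreal (real j) \<partial>measure_pmf (p (e n)))"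
    by (simp add: step)
  also have "(\<Sum>i. \<integral>\<^sup>+x. g (Suc i) x \<partial>?Q) = (\<integral>\<^sup>+x. (\<Sum>i. g (Suc i) x) \<partial>?Q)"
    by (intro nn_integral_suminf[symmetric]) simp
  also have "\<dots> = (\<integral>\<^sup>+x. ennreal (real (?Z n x) / real (?Z m x)) \<partial>?Q)"
  proof (rule nn_integral_cong)
    fix x
    have "(\<Sum>i. g (Suc i) x) = (\<Sum>i<?Z n x. g (Suc i) x)"
      by (intro suminf_finite) (auto simp: g_def)
    also have "\<dots> = (\<Sum>i<?Z n x. ennreal (1 / real (?Z m x)))"
      by (intro sum.cong) (auto simp: g_def)
    also have "\<dots> = ennreal (\<Sum>i<?Z n x. 1 / real (?Z m x))"
      by (intro sum_ennreal) auto
    finally show "(\<Sum>i. g (Suc i) x) = ennreal (real (?Z n x) / real (?Z m x))" by simp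
  qed
  finally show ?thesis .
qed

text \<open>Iteration of the one-generation identity. Equality may fail only through the base case:
  the ratio of \<open>generation_size coord m x\<close> to itself is 1, or 0 by division by zero
  after extinction.\<close>

lemma nn_integral_generation_ratio_le:
  "(\<integral>\<^sup>+x. ennreal (real (generation_size coord (m + n) x) / real (generation_size coord m x)) \<partial>quenched_law p e)
    \<le> (\<Prod>k = m..<m + n. \<integral>\<^sup>+j. ennreal (real j) \<partial>measure_pmf (p (e k)))"
proof (induction n)
  case 0
  interpret Q: prob_space "quenched_law p e" by (rule prob_space_quenched_law)
  have "(\<integral>\<^sup>+x. ennreal (real (generation_size coord m x) / real (generation_size coord m x)) \<partial>quenched_law p e)
      \<le> (\<integral>\<^sup>+x. 1 \<partial>quenched_law p e)"
    by (intro nn_integral_mono) (simp add: divide_self_if)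
  then show ?case by (simp add: Q.emeasure_space_1)
next
  case (Suc n)
  show ?case
    using mult_right_mono[OF Suc, of "\<integral>\<^sup>+j. ennreal (real j) \<partial>measure_pmf (p (e (m + n)))"]
    by (simp only: add_Suc_right nn_integral_generation_ratio_Suc le_add1 prod.atLeastLessThan_Suc zero_le)
qed

section \<open>From the quenched to the annealed law\<close>

context branching_process_random_env
begin

lemma env_measurable: "\<xi> n \<in> measurable M E"
  using env_indep by (auto simp: indep_vars_def)

lemma env_seq_measurable: "(\<lambda>\<omega> n. \<xi> n \<omega>) \<in> measurable M (PiM UNIV (\<lambda>_. E))"
  by (intro measurable_PiM_single') (auto simp: env_measurable measurable_space[OF env_measurable])

lemma offspring_family_measurable:
  "(\<lambda>\<omega>. \<lambda>(n, i)\<in>UNIV \<times> {1..}. N n i \<omega>) \<in> measurable M (PiM (UNIV \<times> {1..}) (\<lambda>_. count_space UNIV))"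
proof -
  have "(\<lambda>\<omega>. \<lambda>q\<in>UNIV \<times> {1..}. N (fst q) (snd q) \<omega>)
      \<in> measurable M (PiM (UNIV \<times> {1..}) (\<lambda>_. count_space UNIV))"
    by (rule measurable_restrict) (auto intro: offspring_measurable)
  then show ?thesis
    by (simp add: case_prod_unfold)
qed

text \<open>The assumption \<open>annealed\<close> identifies the joint law with the mixture of
  quenched laws on measurable rectangles. These are stable under intersection and generate the
  product sigma-algebra, so the two measures agree and every nonnegative \<open>f\<close> can be
  integrated in two stages.\<close>

lemma nn_integral_annealed:
  assumes f: "f \<in> borel_measurable (PiM UNIV (\<lambda>_. E) \<Otimes>\<^sub>M PiM (UNIV \<times> {1..}) (\<lambda>_. count_space UNIV))"
  shows "(\<integral>\<^sup>+\<omega>. f (\<lambda>n. \<xi> n \<omega>, \<lambda>(n, i)\<in>UNIV \<times> {1..}. N n i \<omega>) \<partial>M)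
    = (\<integral>\<^sup>+\<omega>. \<integral>\<^sup>+x. f (\<lambda>n. \<xi> n \<omega>, x) \<partial>quenched_law p (\<lambda>n. \<xi> n \<omega>) \<partial>M)"
proof -
  let ?S = "PiM UNIV (\<lambda>_. E) :: (nat \<Rightarrow> 'e) measure"
  let ?N = "PiM (UNIV \<times> {1..}) (\<lambda>_. count_space UNIV) :: (nat \<times> nat \<Rightarrow> nat) measure"
  let ?X = "\<lambda>\<omega> n. \<xi> n \<omega>" and ?Y = "\<lambda>\<omega>. \<lambda>(n, i)\<in>UNIV \<times> {1..}. N n i \<omega>"
  note [measurable] = env_seq_measurable offspring_family_measurable quenched_law_kernel[OF offspring_law_measurable]
  let ?T = "distr M ?S ?X"
  note One_nat_def[simp del]
  have XY[measurable]: "(\<lambda>\<omega>. (?X \<omega>, ?Y \<omega>)) \<in> measurable M (?S \<Otimes>\<^sub>M ?N)"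
    by (intro measurable_Pair env_seq_measurable offspring_family_measurable)
  \<comment> \<open>The kernel keeps a copy of the environment \<open>e\<close>, because
    \<open>f\<close> depends on both arguments.\<close>
  define K where "K e = distr (quenched_law p e) (?S \<Otimes>\<^sub>M ?N) (Pair e)" for e
  have K': "K \<in> measurable ?S (prob_algebra (?S \<Otimes>\<^sub>M ?N))"
    unfolding K_def by measurable
  then have K[measurable]: "K \<in> measurable ?S (subprob_algebra (?S \<Otimes>\<^sub>M ?N))"
    by (rule measurable_prob_algebraD)
  have ne: "space ?T \<noteq> {}"
    using not_empty measurable_space[OF env_seq_measurable] by (metis all_not_in_conv space_distr)
  have Kmu: "Pair e \<in> measurable (quenched_law p e) (?S \<Otimes>\<^sub>M ?N)" if "e \<in> space ?S" for e
    using that by (subst measurable_cong_sets[OF sets_quenched_law refl]) simp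
  have "distr M (?S \<Otimes>\<^sub>M ?N) (\<lambda>\<omega>. (?X \<omega>, ?Y \<omega>)) = ?T \<bind> K"
  proof (rule measure_eqI_generator_eq[OF Int_stable_pair_measure_generator[of ?S ?N]])
    let ?E = "{a \<times> b | a b. a \<in> sets ?S \<and> b \<in> sets ?N}"
    show "?E \<subseteq> Pow (space ?S \<times> space ?N)"
      using sets.space_closed[of ?S] sets.space_closed[of ?N] by auto
    show "sets (distr M (?S \<Otimes>\<^sub>M ?N) (\<lambda>\<omega>. (?X \<omega>, ?Y \<omega>))) = sigma_sets (space ?S \<times> space ?N) ?E"
      by (simp only: sets_distr sets_pair_measure)
    show "sets (?T \<bind> K) = sigma_sets (space ?S \<times> space ?N) ?E"
      using sets_bind_measurable[of K ?T "?S \<Otimes>\<^sub>M ?N"] K ne by (simp add: sets_pair_measure)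
    show "range (\<lambda>_. space ?S \<times> space ?N) \<subseteq> ?E" by auto
    show "(\<Union>i::nat. space ?S \<times> space ?N) = space ?S \<times> space ?N" by simp
    show "emeasure (distr M (?S \<Otimes>\<^sub>M ?N) (\<lambda>\<omega>. (?X \<omega>, ?Y \<omega>))) (space ?S \<times> space ?N) \<noteq> \<infinity>"
      by (subst emeasure_distr) auto
  next
    fix C assume "C \<in> {a \<times> b | a b. a \<in> sets ?S \<and> b \<in> sets ?N}"
    then obtain A B where C: "C = A \<times> B" and AB[measurable]: "A \<in> sets ?S" "B \<in> sets ?N" by auto
    have "emeasure (distr M (?S \<Otimes>\<^sub>M ?N) (\<lambda>\<omega>. (?X \<omega>, ?Y \<omega>))) C
        = emeasure M {\<omega> \<in> space M. ?X \<omega> \<in> A \<and> ?Y \<omega> \<in> B}"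
      unfolding C by (subst emeasure_distr) (auto intro!: arg_cong[where f = "emeasure M"])
    also have "\<dots> = (\<integral>\<^sup>+e. emeasure (quenched_law p e) B * indicator A e \<partial>?T)"
      by (rule annealed[OF AB])
    also have "\<dots> = (\<integral>\<^sup>+e. emeasure (K e) C \<partial>?T)"
    proof (rule nn_integral_cong)
      fix e assume "e \<in> space ?T"
      then have "emeasure (K e) C = emeasure (quenched_law p e) (Pair e -` C \<inter> space (quenched_law p e))"
        unfolding K_def C by (intro emeasure_distr Kmu) auto
      also have "Pair e -` C \<inter> space (quenched_law p e) = (if e \<in> A then B else {})"
        using sets.sets_into_space[OF AB(2)] sets_eq_imp_space_eq[OF sets_quenched_law, of p e]
        by (auto simp: C)
      finally show "emeasure (quenched_law p e) B * indicator A e = emeasure (K e) C"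
        by simp
    qed
    also have "\<dots> = emeasure (?T \<bind> K) C"
      unfolding C by (rule emeasure_bind[OF ne, where N = "?S \<Otimes>\<^sub>M ?N", symmetric]) (use K in auto)
    finally show "emeasure (distr M (?S \<Otimes>\<^sub>M ?N) (\<lambda>\<omega>. (?X \<omega>, ?Y \<omega>))) C = emeasure (?T \<bind> K) C" .
  qed
  moreover have "(\<integral>\<^sup>+\<omega>. f (?X \<omega>, ?Y \<omega>) \<partial>M) = (\<integral>\<^sup>+z. f z \<partial>distr M (?S \<Otimes>\<^sub>M ?N) (\<lambda>\<omega>. (?X \<omega>, ?Y \<omega>)))"
    using f by (subst nn_integral_distr) auto
  ultimately have "(\<integral>\<^sup>+\<omega>. f (?X \<omega>, ?Y \<omega>) \<partial>M) = (\<integral>\<^sup>+e. \<integral>\<^sup>+z. f z \<partial>K e \<partial>?T)"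
    using f by (simp add: nn_integral_bind[where B = "?S \<Otimes>\<^sub>M ?N"])
  also have "\<dots> = (\<integral>\<^sup>+\<omega>. \<integral>\<^sup>+z. f z \<partial>K (?X \<omega>) \<partial>M)"
    using f by (subst nn_integral_distr) (auto intro: measurable_compose[OF K nn_integral_measurable_subprob_algebra])
  also have "\<dots> = (\<integral>\<^sup>+\<omega>. \<integral>\<^sup>+x. f (?X \<omega>, x) \<partial>quenched_law p (?X \<omega>) \<partial>M)"
    using f unfolding K_def
    by (intro nn_integral_cong nn_integral_distr Kmu) (auto intro: measurable_space[OF env_seq_measurable])
  finally show ?thesis .
qed

text \<open>The restricted family forgets the variables \<open>N n 0\<close>, which the process
  never reads.\<close>

lemma generation_size_offspring_family:
  "generation_size N m \<omega> = generation_size coord m (\<lambda>(n, i)\<in>UNIV \<times> {1..}. N n i \<omega>)"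
  by (rule generation_size_cong) simp

lemma generation_size_process_measurable:
  "generation_size N m \<in> measurable M (count_space UNIV)"
  by (intro generation_size_measurable offspring_measurable)

lemma offspring_mean_measurable: "offspring_mean p \<in> borel_measurable E"
  unfolding offspring_mean_def using offspring_law_measurable by measurable

lemma pmf_mean_measurable:
  "(\<lambda>e. \<integral>\<^sup>+j. ennreal (real j) \<partial>measure_pmf (p e)) \<in> borel_measurable E"
  unfolding nn_integral_measure_pmf nn_integral_count_space_nat
  using offspring_law_measurable by measurable

text \<open>All \<open>\<xi> k\<close> have the same law on \<open>E\<close>, so the statement
  passes through the image measure; the next two lemmas treat integrability and expectation in this
  way.\<close>

lemma AE_env:
  assumes "{e \<in> space E. P e} \<in> sets E" "AE \<omega> in M. P (\<xi> 0 \<omega>)"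
  shows "AE \<omega> in M. P (\<xi> k \<omega>)"
  using assms AE_distr_iff[OF env_measurable assms(1)] env_ident[of k] by metis

lemma integrable_env:
  fixes f :: "'e \<Rightarrow> real"
  assumes "f \<in> borel_measurable E"
  shows "integrable M (\<lambda>\<omega>. f (\<xi> k \<omega>)) \<longleftrightarrow> integrable M (\<lambda>\<omega>. f (\<xi> 0 \<omega>))"
  using integrable_distr_eq[OF env_measurable assms] env_ident[of k] by metis

lemma expectation_env:
  fixes f :: "'e \<Rightarrow> real"
  assumes "f \<in> borel_measurable E"
  shows "expectation (\<lambda>\<omega>. f (\<xi> k \<omega>)) = expectation (\<lambda>\<omega>. f (\<xi> 0 \<omega>))"
  using integral_distr[OF env_measurable assms] env_ident[of k] by metis

text \<open>A weight that depends on the environment alone is constant under the quenched integral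
  and can be pulled out. It will later be the inverse product of the means.\<close>

lemma nn_integral_generation_ratio_weighted:
  assumes c: "c \<in> borel_measurable (PiM UNIV (\<lambda>_. E))"
  shows "(\<integral>\<^sup>+\<omega>. c (\<lambda>k. \<xi> k \<omega>) * ennreal (real (generation_size N (m + n) \<omega>) / real (generation_size N m \<omega>)) \<partial>M)
    \<le> (\<integral>\<^sup>+\<omega>. c (\<lambda>k. \<xi> k \<omega>) * (\<Prod>k = m..<m + n. \<integral>\<^sup>+j. ennreal (real j) \<partial>measure_pmf (p (\<xi> k \<omega>))) \<partial>M)"
proof -
  let ?S = "PiM UNIV (\<lambda>_. E) :: (nat \<Rightarrow> 'e) measure"
  let ?N = "PiM (UNIV \<times> {1..}) (\<lambda>_. count_space UNIV) :: (nat \<times> nat \<Rightarrow> nat) measure"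
  let ?r = "\<lambda>x. ennreal (real (generation_size coord (m + n) x) / real (generation_size coord m x))"
  have [measurable]: "(\<lambda>x. real (generation_size coord k x)) \<in> borel_measurable ?N" for k
    by (rule measurable_compose[OF generation_size_measurable]) (auto intro!: coord_measurable)
  note [measurable] = c
  have "(\<lambda>(e, x). c e * ?r x) \<in> borel_measurable (?S \<Otimes>\<^sub>M ?N)"
    by measurable
  from nn_integral_annealed[OF this]
  have "(\<integral>\<^sup>+\<omega>. c (\<lambda>k. \<xi> k \<omega>) * ennreal (real (generation_size N (m + n) \<omega>) / real (generation_size N m \<omega>)) \<partial>M)
      = (\<integral>\<^sup>+\<omega>. \<integral>\<^sup>+x. c (\<lambda>k. \<xi> k \<omega>) * ?r x \<partial>quenched_law p (\<lambda>k. \<xi> k \<omega>) \<partial>M)"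
    by (simp add: generation_size_offspring_family[symmetric] del: One_nat_def)
  also have "\<dots> = (\<integral>\<^sup>+\<omega>. c (\<lambda>k. \<xi> k \<omega>) * (\<integral>\<^sup>+x. ?r x \<partial>quenched_law p (\<lambda>k. \<xi> k \<omega>)) \<partial>M)"
    by (intro nn_integral_cong nn_integral_cmult, subst measurable_cong_sets[OF sets_quenched_law refl]) measurable
  also have "\<dots> \<le> (\<integral>\<^sup>+\<omega>. c (\<lambda>k. \<xi> k \<omega>) * (\<Prod>k = m..<m + n. \<integral>\<^sup>+j. ennreal (real j) \<partial>measure_pmf (p (\<xi> k \<omega>))) \<partial>M)"
    by (intro nn_integral_mono mult_left_mono nn_integral_generation_ratio_le) simp
  finally show ?thesis .
qed

text \<open>Without childless individuals the offspring number is at least 1 almost surely, hence so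
  is its mean. Summability ensures that the real series is the true mean and not a junk
  value.\<close>

lemma AE_offspring_mean:
  assumes "AE \<omega> in M. pmf (p (\<xi> 0 \<omega>)) 0 = 0"
    and "AE \<omega> in M. summable (\<lambda>i. real i * pmf (p (\<xi> 0 \<omega>)) i)"
  shows "AE \<omega> in M. 1 \<le> offspring_mean p (\<xi> k \<omega>) \<and>
    (\<integral>\<^sup>+j. ennreal (real j) \<partial>measure_pmf (p (\<xi> k \<omega>))) = ennreal (offspring_mean p (\<xi> k \<omega>))"
proof (rule AE_env)
  note [measurable] = pmf_mean_measurable offspring_mean_measurable
  show "{e \<in> space E. 1 \<le> offspring_mean p e \<and>
      (\<integral>\<^sup>+j. ennreal (real j) \<partial>measure_pmf (p e)) = ennreal (offspring_mean p e)} \<in> sets E"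
    by measurable
  show "AE \<omega> in M. 1 \<le> offspring_mean p (\<xi> 0 \<omega>) \<and>
    (\<integral>\<^sup>+j. ennreal (real j) \<partial>measure_pmf (p (\<xi> 0 \<omega>))) = ennreal (offspring_mean p (\<xi> 0 \<omega>))"
    using assms
  proof eventually_elim
    case (elim \<omega>)
    let ?q = "p (\<xi> 0 \<omega>)"
    have "(\<integral>\<^sup>+j. ennreal (real j) \<partial>measure_pmf ?q) = (\<Sum>i. ennreal (real i * pmf ?q i))"
      by (simp add: nn_integral_measure_pmf nn_integral_count_space_nat ennreal_mult' mult.commute)
    also have "\<dots> = ennreal (offspring_mean p (\<xi> 0 \<omega>))"
      unfolding offspring_mean_def using elim(2) by (intro suminf_ennreal2) auto
    finally have eq: "(\<integral>\<^sup>+j. ennreal (real j) \<partial>measure_pmf ?q) = ennreal (offspring_mean p (\<xi> 0 \<omega>))" .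
    have "0 \<notin> set_pmf ?q"
      using elim(1) by (simp add: set_pmf_iff)
    then have "(\<integral>\<^sup>+j. 1 \<partial>measure_pmf ?q) \<le> (\<integral>\<^sup>+j. ennreal (real j) \<partial>measure_pmf ?q)"
      by (intro nn_integral_mono_AE) (auto simp: AE_measure_pmf_iff intro!: ennreal_leI[of 1, simplified] Suc_leI gr0I)
    then have "1 \<le> ennreal (offspring_mean p (\<xi> 0 \<omega>))"
      by (simp add: eq measure_pmf.emeasure_space_1[simplified])
    with eq show ?case
      by simp
  qed
qed

text \<open>Markov's inequality at level \<open>exp y\<close> for the normalized ratio, whose
  annealed mean is at most 1 because the weight \<open>c\<close> cancels the product of the
  means.\<close>

lemma generation_ratio_tail:
  assumes "AE \<omega> in M. pmf (p (\<xi> 0 \<omega>)) 0 = 0"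
    and "AE \<omega> in M. summable (\<lambda>i. real i * pmf (p (\<xi> 0 \<omega>)) i)"
  shows "prob {\<omega> \<in> space M. exp y \<le> (\<Prod>k = m..<m + n. 1 / offspring_mean p (\<xi> k \<omega>)) *
      (real (generation_size N (m + n) \<omega>) / real (generation_size N m \<omega>))} \<le> exp (- y)"
proof -
  define c where "c e = (\<Prod>k = m..<m + n. 1 / offspring_mean p (e k))" for e
  let ?r = "\<lambda>\<omega>. real (generation_size N (m + n) \<omega>) / real (generation_size N m \<omega>)"
  let ?G = "\<lambda>\<omega>. ennreal (c (\<lambda>k. \<xi> k \<omega>)) * ennreal (?r \<omega>)"
  note [measurable] = env_seq_measurable offspring_mean_measurable
  have cm[measurable]: "c \<in> borel_measurable (PiM UNIV (\<lambda>_. E))"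
    unfolding c_def by measurable
  have [measurable]: "(\<lambda>\<omega>. real (generation_size N k \<omega>)) \<in> borel_measurable M" for k
    by (rule measurable_compose[OF generation_size_process_measurable]) simp
  have AE: "AE \<omega> in M. \<forall>k. 1 \<le> offspring_mean p (\<xi> k \<omega>) \<and>
      (\<integral>\<^sup>+j. ennreal (real j) \<partial>measure_pmf (p (\<xi> k \<omega>))) = ennreal (offspring_mean p (\<xi> k \<omega>))"
    unfolding AE_all_countable using AE_offspring_mean[OF assms] by blast
  have "(\<integral>\<^sup>+\<omega>. ?G \<omega> \<partial>M)
      \<le> (\<integral>\<^sup>+\<omega>. ennreal (c (\<lambda>k. \<xi> k \<omega>)) * (\<Prod>k = m..<m + n. \<integral>\<^sup>+j. ennreal (real j) \<partial>measure_pmf (p (\<xi> k \<omega>))) \<partial>M)"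
    by (rule nn_integral_generation_ratio_weighted) measurable
  also have "\<dots> = (\<integral>\<^sup>+\<omega>. 1 \<partial>M)"
  proof (rule nn_integral_cong_AE)
    show "AE \<omega> in M. ennreal (c (\<lambda>k. \<xi> k \<omega>)) *
        (\<Prod>k = m..<m + n. \<integral>\<^sup>+j. ennreal (real j) \<partial>measure_pmf (p (\<xi> k \<omega>))) = 1"
      using AE
    proof eventually_elim
      case (elim \<omega>)
      have pos: "0 < offspring_mean p (\<xi> k \<omega>)" for k
        using elim by (smt (verit))
      have "(\<Prod>k = m..<m + n. \<integral>\<^sup>+j. ennreal (real j) \<partial>measure_pmf (p (\<xi> k \<omega>)))
          = ennreal (\<Prod>k = m..<m + n. offspring_mean p (\<xi> k \<omega>))"
        using elim pos by (simp add: prod_ennreal less_imp_le)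
      moreover have "c (\<lambda>k. \<xi> k \<omega>) * (\<Prod>k = m..<m + n. offspring_mean p (\<xi> k \<omega>)) = 1"
        unfolding c_def prod.distrib[symmetric] using pos
        by (intro prod.neutral) (auto simp: less_imp_neq[THEN not_sym])
      moreover have "0 \<le> (\<Prod>k = m..<m + n. offspring_mean p (\<xi> k \<omega>))" "0 \<le> c (\<lambda>k. \<xi> k \<omega>)"
        unfolding c_def using pos by (auto intro!: prod_nonneg simp: less_imp_le)
      ultimately show ?case
        by (simp add: ennreal_mult[symmetric])
    qed
  qed
  also have "\<dots> = 1" by (simp add: emeasure_space_1)
  finally have E1: "(\<integral>\<^sup>+\<omega>. ?G \<omega> \<partial>M) \<le> 1" .
  \<comment> \<open>The real product and its extended counterpart \<open>?G\<close> are compared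
    where \<open>c\<close> is nonnegative, which is known almost surely only.\<close>
  have "emeasure M {\<omega> \<in> space M. exp y \<le> c (\<lambda>k. \<xi> k \<omega>) * ?r \<omega>}
      \<le> emeasure M {\<omega> \<in> space M. 1 \<le> ennreal (exp (- y)) * ?G \<omega>}"
  proof (rule emeasure_mono_AE)
    show "AE \<omega> in M. \<omega> \<in> {\<omega> \<in> space M. exp y \<le> c (\<lambda>k. \<xi> k \<omega>) * ?r \<omega>} \<longrightarrow>
        \<omega> \<in> {\<omega> \<in> space M. 1 \<le> ennreal (exp (- y)) * ?G \<omega>}"
      using AE
    proof eventually_elim
      case (elim \<omega>)
      have "0 \<le> c (\<lambda>k. \<xi> k \<omega>)"
        unfolding c_def using elim by (intro prod_nonneg) (smt (verit) divide_nonneg_nonneg)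
      then have "ennreal (exp (- y)) * ?G \<omega> = ennreal (exp (- y) * (c (\<lambda>k. \<xi> k \<omega>) * ?r \<omega>))"
        by (simp add: ennreal_mult del: times_divide_eq_right)
      moreover have "1 \<le> exp (- y) * (c (\<lambda>k. \<xi> k \<omega>) * ?r \<omega>)" if "exp y \<le> c (\<lambda>k. \<xi> k \<omega>) * ?r \<omega>"
        using mult_left_mono[OF that, of "exp (- y)"] by (simp flip: exp_add)
      ultimately show ?case by auto
    qed
  qed measurable
  also have "\<dots> \<le> ennreal (exp (- y)) * (\<integral>\<^sup>+\<omega>. ?G \<omega> * indicator (space M) \<omega> \<partial>M)"
    by (rule nn_integral_Markov_inequality) measurable
  also have "(\<integral>\<^sup>+\<omega>. ?G \<omega> * indicator (space M) \<omega> \<partial>M) = (\<integral>\<^sup>+\<omega>. ?G \<omega> \<partial>M)"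
    by (intro nn_integral_cong) simp
  also have "ennreal (exp (- y)) * (\<integral>\<^sup>+\<omega>. ?G \<omega> \<partial>M) \<le> ennreal (exp (- y))"
    using mult_left_mono[OF E1, of "ennreal (exp (- y))"] by simp
  finally show ?thesis
    by (simp add: c_def emeasure_eq_measure)
qed

end

section \<open>Comparison of the exponents and combination of the two tails\<close>

lemma half_deviation_exponent_le:
  fixes x s u \<alpha> :: real
  assumes "0 < x" "0 < s" "0 \<le> u" "\<alpha> < 2"
  shows "x\<^sup>2 / (8 * (u + s powr (- \<alpha>) * x powr (2 - \<alpha>)))
    \<le> (x * s / 2)\<^sup>2 / (2 * (s\<^sup>2 * u + (x * s / 2) powr (2 - \<alpha>)))"
proof -
  let ?D = "u + s powr (- \<alpha>) * x powr (2 - \<alpha>)"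
  have "s\<^sup>2 * s powr (- \<alpha>) = s powr (2 - \<alpha>)"
    using assms by (simp add: powr_diff powr_minus divide_inverse)
  then have s: "s\<^sup>2 * (s powr (- \<alpha>) * x powr (2 - \<alpha>)) = (x * s) powr (2 - \<alpha>)"
    using assms by (simp add: powr_mult mult.assoc[symmetric] mult.commute)
  \<comment> \<open>Dropping the factor 1/2 inside the power is the only loss. The constant 8 is
    exact otherwise: 4 from squaring \<open>x * s / 2\<close>, times the 2 of the tail
    bound.\<close>
  have "(x * s / 2) powr (2 - \<alpha>) \<le> (x * s) powr (2 - \<alpha>)"
    using assms by (intro powr_mono2) auto
  then have le: "s\<^sup>2 * u + (x * s / 2) powr (2 - \<alpha>) \<le> s\<^sup>2 * ?D"
    by (simp add: distrib_left s)
  have pos: "0 < s\<^sup>2 * u + (x * s / 2) powr (2 - \<alpha>)"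
    using assms by (intro add_nonneg_pos) auto
  have "x\<^sup>2 / (8 * ?D) = (x * s / 2)\<^sup>2 / (2 * (s\<^sup>2 * ?D))"
    using assms by (simp add: power_mult_distrib power_divide)
  also have "\<dots> \<le> (x * s / 2)\<^sup>2 / (2 * (s\<^sup>2 * u + (x * s / 2) powr (2 - \<alpha>)))"
    using le pos by (intro divide_left_mono) auto
  finally show ?thesis .
qed

text \<open>Dropping \<open>u\<close> leaves \<open>(x * s) powr \<alpha> / 8\<close>, which is at
  most \<open>x * s / 8\<close> if \<open>x * s \<ge> 1\<close> and at most 1/8 otherwise. This
  compares the claimed exponent with the exponent \<open>y\<close> of the normalized ratio.\<close>

lemma half_deviation_le:
  fixes x s u \<alpha> :: real
  assumes "0 < x" "0 < s" "0 \<le> u" "0 < \<alpha>" "\<alpha> < 1"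
  shows "x\<^sup>2 / (8 * (u + s powr (- \<alpha>) * x powr (2 - \<alpha>))) \<le> max (1 / 8) (x * s / 2)"
proof -
  have pos: "0 < s powr (- \<alpha>) * x powr (2 - \<alpha>)" using assms by simp
  have "x\<^sup>2 / (8 * (u + s powr (- \<alpha>) * x powr (2 - \<alpha>))) \<le> x\<^sup>2 / (8 * (s powr (- \<alpha>) * x powr (2 - \<alpha>)))"
    using pos add_nonneg_pos[OF assms(3) pos] assms by (intro divide_left_mono mult_left_mono mult_pos_pos) auto
  also have "\<dots> = (x * s) powr \<alpha> / 8"
    using assms by (simp add: powr_mult powr_diff powr_minus field_simps)
  also have "\<dots> \<le> max (1 / 8) (x * s / 2)"
  proof (cases "x * s \<le> 1")
    case True
    then have "(x * s) powr \<alpha> \<le> 1"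
      using assms by (intro powr_le1) auto
    then show ?thesis by simp
  next
    case False
    then have "(x * s) powr \<alpha> \<le> (x * s) powr 1"
      using assms by (intro powr_mono) auto
    then show ?thesis using False by simp
  qed
  finally show ?thesis .
qed

theorem theorem2p2:
  fixes M :: "'a measure" and E :: "'e measure"
    and p :: "'e \<Rightarrow> nat pmf" and \<xi> :: "nat \<Rightarrow> 'a \<Rightarrow> 'e"
    and N :: "nat \<Rightarrow> nat \<Rightarrow> 'a \<Rightarrow> nat"
    and Z :: "nat \<Rightarrow> 'a \<Rightarrow> nat" and X :: "'a \<Rightarrow> real"
    and \<mu> \<sigma> \<alpha> u x :: real and n0 n :: nat
  assumes bpre: "branching_process_random_env M E p \<xi> N"
    and Z: "Z = generation_size N"
    and no_extinction: "AE \<omega> in M. pmf (p (\<xi> 0 \<omega>)) 0 = 0"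
    and mean_finite: "AE \<omega> in M. summable (\<lambda>i. real i * pmf (p (\<xi> 0 \<omega>)) i)"
    and X: "X = (\<lambda>\<omega>. ln (offspring_mean p (\<xi> 0 \<omega>)))"
    and X_integrable: "integrable M X"
    and mu: "\<mu> = integral\<^sup>L M X"
    and variance_finite: "integrable M (\<lambda>\<omega>. (X \<omega> - \<mu>)\<^sup>2)"
    and sigma: "\<sigma> = sqrt (integral\<^sup>L M (\<lambda>\<omega>. (X \<omega> - \<mu>)\<^sup>2))"
    and sigma_pos: "0 < \<sigma>"
    and alpha: "0 < \<alpha>" "\<alpha> < 1"
    and exp_moment: "integrable M (\<lambda>\<omega>. (X \<omega> - \<mu>)\<^sup>2 * exp (max (X \<omega> - \<mu>) 0 powr \<alpha>))"
    and u: "u = 1 / \<sigma>\<^sup>2 *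
      integral\<^sup>L M (\<lambda>\<omega>. (X \<omega> - \<mu>)\<^sup>2 * exp (max (X \<omega> - \<mu>) 0 powr \<alpha>))"
    and n: "n \<ge> 1"
    and x: "x > 0"
  shows "measure M {\<omega> \<in> space M.
      (ln (real (Z (n0 + n) \<omega>) / real (Z n0 \<omega>)) - real n * \<mu>) / (\<sigma> * sqrt (real n)) \<ge> x}
    \<le> 3 * exp (- (x\<^sup>2 / (8 * (u + (\<sigma> * sqrt (real n)) powr (- \<alpha>) * x powr (2 - \<alpha>)))))"
proof -
  interpret branching_process_random_env M E p \<xi> N by (rule bpre)
  define s where "s = \<sigma> * sqrt (real n)"
  define y where "y = x * s / 2"
  define I where "I = {n0..<n0 + n}"
  define g where "g e = ln (offspring_mean p e) - \<mu>" for e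
  define Q where "Q v = v\<^sup>2 * exp (max v 0 powr \<alpha>)" for v
  define D where "D = u + s powr (- \<alpha>) * x powr (2 - \<alpha>)"
  note [measurable] = offspring_mean_measurable env_measurable
  have [measurable]: "g \<in> borel_measurable E" "Q \<in> borel_measurable borel"
    unfolding g_def Q_def by measurable
  have s: "0 < s" using sigma_pos n by (simp add: s_def)
  have y: "0 < y" using s x by (simp add: y_def)
  have u0: "0 \<le> u" unfolding u by (intro mult_nonneg_nonneg Bochner_Integration.integral_nonneg) auto
  have X0: "X \<omega> - \<mu> = g (\<xi> 0 \<omega>)" for \<omega>
    by (simp add: X g_def)
  have AE: "AE \<omega> in M. \<forall>k. 1 \<le> offspring_mean p (\<xi> k \<omega>)"
    unfolding AE_all_countable using AE_offspring_mean[OF no_extinction mean_finite] by (auto elim: eventually_mono)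
  have mu0: "0 \<le> \<mu>"
    unfolding mu using AE by (intro integral_nonneg_AE) (auto simp: X elim: eventually_mono)
  \<comment> \<open>The \<open>n\<close> equal moments add up to
    \<open>n * \<sigma>\<^sup>2 * u\<close>, which is the \<open>B\<close> of the tail bound for
    independent sums.\<close>
  have B: "s\<^sup>2 * u = (\<Sum>k\<in>I. expectation (\<lambda>\<omega>. Q (g (\<xi> k \<omega>))))"
  proof -
    have "(\<Sum>k\<in>I. expectation (\<lambda>\<omega>. Q (g (\<xi> k \<omega>)))) = (\<Sum>k\<in>I. expectation (\<lambda>\<omega>. Q (g (\<xi> 0 \<omega>))))"
      by (intro sum.cong refl expectation_env[of "\<lambda>e. Q (g e)"]) measurable
    then show ?thesis
      using sigma_pos by (simp add: u X0 s_def I_def power_mult_distrib Q_def)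
  qed
  have "prob {\<omega> \<in> space M. y \<le> (\<Sum>k\<in>I. g (\<xi> k \<omega>))}
      \<le> 2 * exp (- (y\<^sup>2 / (2 * (s\<^sup>2 * u + y powr (2 - \<alpha>)))))"
  proof (rule indep_sum_subexponential_tail)
    show "finite I" by (simp add: I_def)
    show "indep_vars (\<lambda>_. borel) (\<lambda>k \<omega>. g (\<xi> k \<omega>)) I"
      by (rule indep_vars_subset[OF indep_vars_compose2[OF env_indep, where Y = "\<lambda>_. g"]]) auto
    show "integrable M (\<lambda>\<omega>. g (\<xi> k \<omega>))" for k
      using X_integrable integrable_env[of g k] by (simp flip: X0)
    show "expectation (\<lambda>\<omega>. g (\<xi> k \<omega>)) \<le> 0" for k
      using X_integrable expectation_env[of g k] by (simp add: mu prob_space flip: X0)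
    show "integrable M (\<lambda>\<omega>. (g (\<xi> k \<omega>))\<^sup>2 * exp (max (g (\<xi> k \<omega>)) 0 powr \<alpha>))" for k
      using exp_moment integrable_env[of "\<lambda>e. Q (g e)" k] by (simp add: X0 Q_def)
  qed (use alpha y B in \<open>auto simp: Q_def\<close>)
  also have "\<dots> \<le> 2 * exp (- (x\<^sup>2 / (8 * D)))"
    using half_deviation_exponent_le[of x s u \<alpha>] x s u0 alpha by (simp add: D_def y_def)
  finally have tail1: "prob {\<omega> \<in> space M. y \<le> (\<Sum>k\<in>I. g (\<xi> k \<omega>))} \<le> 2 * exp (- (x\<^sup>2 / (8 * D)))" .
  let ?r = "\<lambda>\<omega>. real (Z (n0 + n) \<omega>) / real (Z n0 \<omega>)"
  let ?A = "{\<omega> \<in> space M. (ln (?r \<omega>) - real n * \<mu>) / (\<sigma> * sqrt (real n)) \<ge> x}"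
  let ?A1 = "{\<omega> \<in> space M. y \<le> (\<Sum>k\<in>I. g (\<xi> k \<omega>))}"
  let ?A2 = "{\<omega> \<in> space M. exp y \<le> (\<Prod>k\<in>I. 1 / offspring_mean p (\<xi> k \<omega>)) * ?r \<omega>}"
  have [measurable]: "(\<lambda>\<omega>. real (Z k \<omega>)) \<in> borel_measurable M" for k
    unfolding Z by (rule measurable_compose[OF generation_size_process_measurable]) simp
  have "AE \<omega> in M. \<omega> \<in> ?A \<longrightarrow> \<omega> \<in> ?A1 \<union> ?A2"
    using AE
  proof eventually_elim
    case (elim \<omega>)
    have pos: "0 < offspring_mean p (\<xi> k \<omega>)" for k
      using elim by (smt (verit))
    show ?case
    proof (intro impI)
      assume w: "\<omega> \<in> ?A"
      then have ln_r: "real n * \<mu> + 2 * y \<le> ln (?r \<omega>)"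
        using s by (simp add: y_def s_def[symmetric] pos_le_divide_eq)
      \<comment> \<open>\<open>\<mu> \<ge> 0\<close> makes the logarithm positive, which excludes its junk value \<open>ln 0 = 0\<close>.\<close>
      have "0 < ln (?r \<omega>)"
        using ln_r y mu0 by (smt (verit) mult_nonneg_nonneg of_nat_0_le_iff)
      then have r: "0 < ?r \<omega>"
        using divide_nonneg_nonneg[OF of_nat_0_le_iff of_nat_0_le_iff, of "Z (n0 + n) \<omega>" "Z n0 \<omega>"] ln_0
        by (metis less_irrefl order_le_less)
      let ?c = "\<Prod>k\<in>I. 1 / offspring_mean p (\<xi> k \<omega>)"
      have c: "0 < ?c"
        using pos by (intro prod_pos) auto
      have "ln ?c = (\<Sum>k\<in>I. ln (1 / offspring_mean p (\<xi> k \<omega>)))"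
        using less_imp_neq[OF pos] by (intro ln_prod) (auto simp: I_def)
      also have "\<dots> = (\<Sum>k\<in>I. - \<mu> - g (\<xi> k \<omega>))"
        using less_imp_neq[OF pos] by (intro sum.cong refl) (auto simp: g_def ln_div)
      also have "\<dots> = - real n * \<mu> - (\<Sum>k\<in>I. g (\<xi> k \<omega>))"
        by (simp add: sum_subtractf I_def)
      \<comment> \<open>The deviation \<open>ln (?r \<omega>) - real n * \<mu>\<close>, at least
        \<open>2 * y\<close>, is split into the centred sum and the logarithm of the normalized
        ratio. If the first stays below \<open>y\<close>, the second is at least
        \<open>y\<close>.\<close>
      finally have "ln (?c * ?r \<omega>) = ln (?r \<omega>) - real n * \<mu> - (\<Sum>k\<in>I. g (\<xi> k \<omega>))"
        using ln_mult_pos[OF c r] by linarith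
      then have "y \<le> ln (?c * ?r \<omega>)" if "\<omega> \<notin> ?A1"
        using that w ln_r by auto
      moreover have "0 < ?c * ?r \<omega>"
        using c r by (rule mult_pos_pos)
      ultimately show "\<omega> \<in> ?A1 \<union> ?A2"
        using w ln_ge_iff by blast
    qed
  qed
  then have "prob ?A \<le> prob (?A1 \<union> ?A2)"
    by (rule finite_measure_mono_AE) measurable
  also have "\<dots> \<le> prob ?A1 + prob ?A2"
    by (intro measure_Un_le) measurable
  also have "prob ?A2 \<le> exp (- y)"
    unfolding Z I_def by (rule generation_ratio_tail[OF no_extinction mean_finite])
  finally have sum: "prob ?A \<le> 2 * exp (- (x\<^sup>2 / (8 * D))) + exp (- y)"
    using tail1 by simp
  have "prob ?A \<le> 3 * exp (- (x\<^sup>2 / (8 * D)))"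
  \<comment> \<open>Either \<open>exp (- y)\<close> is absorbed as the third copy of the
    exponential, or the exponent is at most 1/8 and \<open>3 * (1 - 1/8) > 1\<close> makes the claim
    trivial.\<close>
  proof (cases "x\<^sup>2 / (8 * D) \<le> y")
    case True
    then have "exp (- y) \<le> exp (- (x\<^sup>2 / (8 * D)))" by simp
    with sum show ?thesis by linarith
  next
    case False
    then have "x\<^sup>2 / (8 * D) \<le> 1 / 8"
      using half_deviation_le[OF x s u0 alpha] unfolding D_def y_def by linarith
    then have "1 \<le> 3 * exp (- (x\<^sup>2 / (8 * D)))"
      using exp_ge_add_one_self[of "- (x\<^sup>2 / (8 * D))"] by linarith
    with prob_le_1[of ?A] show ?thesis by linarith
  qed
  then show ?thesis
    by (simp add: D_def s_def)
qed

end
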